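(* For any set $\Gamma\cup\{\phi\}$ of $\mathbf{CPL}(\subseteq_0)$-formulas, if $\Gamma\vdash\phi$ in the natural deduction system of $\mathbf{CPL}(\subseteq_0)$, then $\Gamma\models\phi$.
   Context: Fix a set $\mathsf{Prop}$ of propositional variables. Classical formulas: $\alpha::=p\mid\bot\mid\top\mid\neg\alpha\mid(\alpha\wedge\alpha)\mid(\alpha\vee\alpha)$ with $p\in\mathsf{Prop}$. Formulas of $\mathbf{CPL}(\subseteq_0)$: $\phi::=p\mid\bot\mid\top\mid\neg\alpha\mid\mathsf x\subseteq\mathsf a\mid(\phi\wedge\phi)\mid(\phi\vee\phi)$ with $\alpha$ classical and $\mathsf x\subseteq\mathsf a$ a primitive inclusion atom: $\mathsf x=x_1\dots x_k$, $\mathsf a=a_1\dots a_k$ with $x_i\in\{\bot,\top\}$, $a_i\in\mathsf{Prop}\cup\{\bot,\top\}$ (empty sequences allowed). For $\mathsf N\subseteq\mathsf{Prop}$, a valuation on $\mathsf N$ is a function $v:\mathsf N\cup\{\bot,\top\}\to\{0,1\}$ with $v(\bot)=0$, $v(\top)=1$; an $\mathsf N$-team is a set $X$ of valuations on $\mathsf N$, with $\mathsf{dom}(X)=\mathsf N$ (the empty set is a team of any domain); $v(a_1\dots a_k)=\langle v(a_1),\dots,v(a_k)\rangle$. Team semantics, for $X$ whose domain contains the variables of $\phi$: $X\models p$ iff $v(p)=1$ for all $v\in X$; $X\models\bot$ iff $X=\emptyset$; $X\models\top$ always; $X\models\neg\alpha$ iff $\{v\}\not\models\alpha$ for all $v\in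 X$; $X\models\phi\wedge\psi$ iff $X\models\phi$ and $X\models\psi$; $X\models\phi\vee\psi$ iff there are $Y,Z\subseteq X$ with $X=Y\cup Z$, $Y\models\phi$, $Z\models\psi$; $X\models\mathsf a\subseteq\mathsf b$ iff for all $v\in X$ there is $u\in X$ with $v(\mathsf a)=u(\mathsf b)$. $\Gamma\models\phi$ means: every team whose domain contains all variables of $\Gamma\cup\{\phi\}$ and which satisfies every $\gamma\in\Gamma$ satisfies $\phi$. Notation: $p^\top:=p$, $p^\bot:=\neg p$, $\top^\top:=\top$, $\bot^\bot:=\neg\bot$, $\top^\bot:=\bot^\top:=\bot$; $\mathsf a^{\mathsf x}:=a_1^{x_1}\wedge\dots\wedge a_k^{x_k}$ ($\top$ if $k=0$). Natural deduction system of $\mathbf{CPL}(\subseteq_0)$: $\Gamma\vdash\phi$ means there is a derivation of $\phi$ all of whose undischarged assumptions lie in $\Gamma$. In sequent notation, $\vdash$ is the least relation such that $\Gamma\vdash\phi$ for $\phi\in\Gamma$, $\Gamma\vdash\phi$ implies $\Gamma\cup\Gamma'\vdash\phi$, and which is closed under the following rules (all formulas being formulas of $\mathbf{CPL}(\subseteq_0)$), where $\alpha$ ranges over classical formulas, $\Gamma$ over sets of formulas, $\Delta$ over sets of classical formulas only, $\mathsf a,\mathsf b,\mathsf c,\mathsf d,\mathsf a',\dots$ over possibly empty sequences of elements of $\mathsf{Prop}\cup\{\top,\bot\}$ of matching lengths, $\mathsf x,\mathsf x_i$ over sequences of constants $\top,\bot$, and $p$ over variables: - $\top$I: $\Gamma\vdash\top$.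 $\neg$I: from $\Delta,\alpha\vdash\bot$ infer $\Delta\vdash\neg\alpha$. RAA: from $\Delta,\neg\alpha\vdash\bot$ infer $\Delta\vdash\alpha$. $\neg$E: from $\Gamma\vdash\alpha$, $\Gamma\vdash\neg\alpha$ infer $\Gamma\vdash\phi$. - $\wedge$I: from $\Gamma\vdash\phi$, $\Gamma\vdash\psi$ infer $\Gamma\vdash\phi\wedge\psi$. $\wedge$E: from $\Gamma\vdash\phi\wedge\psi$ infer $\Gamma\vdash\phi$, and infer $\Gamma\vdash\psi$. - $\vee$I: from $\Gamma\vdash\phi$ infer $\Gamma\vdash\phi\vee\psi$, and infer $\Gamma\vdash\psi\vee\phi$. $\vee$E: from $\Gamma\vdash\phi\vee\psi$, $\Delta,\phi\vdash\chi$, $\Delta,\psi\vdash\chi$ infer $\Gamma\cup\Delta\vdash\chi$. - $\subseteq$Exc: from $\Gamma\vdash\mathsf{abc}\subseteq\mathsf{a'b'c'}$ infer $\Gamma\vdash\mathsf{bac}\subseteq\mathsf{b'a'c'}$. $\subseteq$Ctr: from $\Gamma\vdash\mathsf{ab}\subseteq\mathsf{cd}$ infer $\Gamma\vdash\mathsf a\subseteq\mathsf c$. $\subseteq$Wk: from $\Gamma\vdash\mathsf{ab}\subseteq\mathsf{cd}$ infer $\Gamma\vdash\mathsf{aab}\subseteq\mathsf{ccd}$ (with $|\mathsf a|=|\mathsf a'|$, $|\mathsf b|=|\mathsf b'|$, resp. $|\mathsf a|=|\mathsf c|$). - $\subseteq$Trs: from $\Gamma\vdash\mathsf a\subseteq\mathsf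 b$, $\Gamma\vdash\mathsf b\subseteq\mathsf c$ infer $\Gamma\vdash\mathsf a\subseteq\mathsf c$. $\subseteq$Id: $\Gamma\vdash\mathsf a\subseteq\mathsf a$. - $\subseteq$Cmp: from $\Gamma\vdash\mathsf a\subseteq\mathsf b$ and $\Gamma\vdash\alpha(\mathsf b)$ infer $\Gamma\vdash\alpha(\mathsf a)$; here $\alpha(\mathsf b)$ and $\alpha(\mathsf a)$ are obtained from a classical formula $\alpha(r_1,\dots,r_k)$ whose only atoms are placeholder variables $r_1,\dots,r_k$ by substituting $b_i$, respectively $a_i$, for $r_i$. - $\subseteq_0$Ext: from $\Gamma\vdash\mathsf a\subseteq\mathsf b$ infer $\Gamma\vdash\top\mathsf a\subseteq\top\mathsf b$, and infer $\Gamma\vdash\bot\mathsf a\subseteq\bot\mathsf b$; from $\Gamma\vdash p$, $\Gamma\vdash\mathsf a\subseteq\mathsf b$ infer $\Gamma\vdash\top\mathsf a\subseteq p\mathsf b$; from $\Gamma\vdash\neg p$, $\Gamma\vdash\mathsf a\subseteq\mathsf b$ infer $\Gamma\vdash\bot\mathsf a\subseteq p\mathsf b$. - $\vee_{\subseteq_0}$E: from $\Gamma\vdash(\phi\wedge\mathsf x\subseteq\mathsf a)\vee\psi$, $\Gamma,\phi,\mathsf x\subseteq\mathsf a\vdash\chi$, $\Gamma,\psi\vdash\chi$ and $\Gamma,\phi\vee\psi,\mathsf x\subseteq\mathsf a\vdash\chi$ infer $\Gamma\vdash\chi$. - $\subseteq_0$Dst: from $\Gamma\vdash\phi\vee\psi$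 and $\Gamma\vdash\mathsf x_i\subseteq\mathsf a_i$ for $i=1,\dots,k$ infer $\Gamma\vdash\big((\phi\vee\mathsf a_1^{\mathsf x_1}\vee\dots\vee\mathsf a_k^{\mathsf x_k})\wedge\mathsf x_1\subseteq\mathsf a_1\wedge\dots\wedge\mathsf x_k\subseteq\mathsf a_k\big)\vee\psi$. *)

theory Defs
  imports Main
begin

text \<open>The set of propositional variables is the type \<open>'p\<close>.  The elements of
  \<open>Prop \<union> {\<bottom>, \<top>}\<close> are represented by \<open>'p atm\<close>, where \<open>Con True\<close> is \<open>\<top>\<close> and
  \<open>Con False\<close> is \<open>\<bottom>\<close>; a sequence of constants is \<open>map Con x\<close> for a list \<open>x\<close> of booleans.\<close>

datatype 'p atm = PVar 'p | Con bool

text \<open>Raw syntax; the formulas of the logic are those satisfying \<open>cpl\<close> below.  An atom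
  \<open>Incl a b\<close> stands for \<open>a \<subseteq> b\<close>.\<close>

datatype (vars: 'p) fm =
    Var 'p
  | Bot
  | Top
  | Neg "'p fm"
  | Incl "'p atm list" "'p atm list"
  | And "'p fm" "'p fm"
  | Or "'p fm" "'p fm"

primrec classical :: "'p fm \<Rightarrow> bool" where
  "classical (Var p) \<longleftrightarrow> True"
| "classical Bot \<longleftrightarrow> True"
| "classical Top \<longleftrightarrow> True"
| "classical (Neg \<alpha>) \<longleftrightarrow> classical \<alpha>"
| "classical (Incl a b) \<longleftrightarrow> False"
| "classical (And \<alpha> \<beta>) \<longleftrightarrow> classical \<alpha> \<and> classical \<beta>"
| "classical (Or \<alpha> \<beta>) \<longleftrightarrow> classical \<alpha> \<and> classical \<beta>"

primrec cpl :: "'p fm \<Rightarrow> bool" where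
  "cpl (Var p) \<longleftrightarrow> True"
| "cpl Bot \<longleftrightarrow> True"
| "cpl Top \<longleftrightarrow> True"
| "cpl (Neg \<alpha>) \<longleftrightarrow> classical \<alpha>"
| "cpl (Incl a b) \<longleftrightarrow> length a = length b \<and> set a \<subseteq> range Con"
| "cpl (And \<phi> \<psi>) \<longleftrightarrow> cpl \<phi> \<and> cpl \<psi>"
| "cpl (Or \<phi> \<psi>) \<longleftrightarrow> cpl \<phi> \<and> cpl \<psi>"

definition CPL :: "'p fm set" where
  "CPL = {\<phi>. cpl \<phi>}"

definition Classical :: "'p fm set" where
  "Classical = {\<alpha>. classical \<alpha>}"

text \<open>A valuation on \<open>N\<close> is a partial map with domain \<open>N\<close>; \<open>val v\<close> is its extension to the
  constants, and is only meaningful on variables in \<open>dom v\<close>.\<close>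

type_synonym 'p team = "('p \<rightharpoonup> bool) set"

primrec val :: "('p \<rightharpoonup> bool) \<Rightarrow> 'p atm \<Rightarrow> bool" where
  "val v (PVar p) \<longleftrightarrow> v p = Some True"
| "val v (Con c) \<longleftrightarrow> c"

definition team :: "'p set \<Rightarrow> 'p team \<Rightarrow> bool" where
  "team N X \<longleftrightarrow> (\<forall>v\<in>X. dom v = N)"

primrec sat :: "'p fm \<Rightarrow> 'p team \<Rightarrow> bool" where
  "sat (Var p) X \<longleftrightarrow> (\<forall>v\<in>X. val v (PVar p))"
| "sat Bot X \<longleftrightarrow> X = {}"
| "sat Top X \<longleftrightarrow> True"
| "sat (Neg \<alpha>) X \<longleftrightarrow> (\<forall>v\<in>X. \<not> sat \<alpha> {v})"
| "sat (Incl a b) X \<longleftrightarrow> (\<forall>v\<in>X. \<exists>u\<in>X. map (val v) a = map (val u) b)"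
| "sat (And \<phi> \<psi>) X \<longleftrightarrow> sat \<phi> X \<and> sat \<psi> X"
| "sat (Or \<phi> \<psi>) X \<longleftrightarrow>
     (\<exists>Y Z. Y \<subseteq> X \<and> Z \<subseteq> X \<and> X = Y \<union> Z \<and> sat \<phi> Y \<and> sat \<psi> Z)"

definition entails :: "'p fm set \<Rightarrow> 'p fm \<Rightarrow> bool"  (infix "\<Turnstile>" 50) where
  "\<Gamma> \<Turnstile> \<phi> \<longleftrightarrow>
     (\<forall>N X. team N X \<and> (\<forall>\<psi>\<in>\<Gamma> \<union> {\<phi>}. vars \<psi> \<subseteq> N) \<and> (\<forall>\<gamma>\<in>\<Gamma>. sat \<gamma> X) \<longrightarrow> sat \<phi> X)"

text \<open>\<open>lit a x\<close> is \<open>a\<close> with exponent \<open>x\<close>, and \<open>lits a x\<close> is its extension to sequences.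
  Iterated conjunctions and disjunctions associate to the left.\<close>

fun lit :: "'p atm \<Rightarrow> bool \<Rightarrow> 'p fm" where
  "lit (PVar p) True = Var p"
| "lit (PVar p) False = Neg (Var p)"
| "lit (Con True) True = Top"
| "lit (Con False) False = Neg Bot"
| "lit (Con True) False = Bot"
| "lit (Con False) True = Bot"

fun conj_list :: "'p fm list \<Rightarrow> 'p fm" where
  "conj_list [] = Top"
| "conj_list (\<phi> # \<phi>s) = foldl And \<phi> \<phi>s"

definition lits :: "'p atm list \<Rightarrow> bool list \<Rightarrow> 'p fm" where
  "lits a x = conj_list (map2 lit a x)"

text \<open>A formula \<open>\<alpha>(r\<^sub>1, \<dots>, r\<^sub>k)\<close> in placeholders is a formula over the variables
  \<open>0, \<dots>, k - 1 :: nat\<close>, and \<open>plug \<alpha> b\<close> is the result of simultaneously substituting the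
  entries of \<open>b\<close> for them.  It is only used when \<open>\<alpha>\<close> is classical and its variables are
  below \<open>length b\<close>.\<close>

primrec atm_fm :: "'p atm \<Rightarrow> 'p fm" where
  "atm_fm (PVar p) = Var p"
| "atm_fm (Con c) = (if c then Top else Bot)"

primrec plug_atm :: "nat atm \<Rightarrow> 'p atm list \<Rightarrow> 'p atm" where
  "plug_atm (PVar i) b = b ! i"
| "plug_atm (Con c) b = Con c"

primrec plug :: "nat fm \<Rightarrow> 'p atm list \<Rightarrow> 'p fm" where
  "plug (Var i) b = atm_fm (b ! i)"
| "plug Bot b = Bot"
| "plug Top b = Top"
| "plug (Neg \<alpha>) b = Neg (plug \<alpha> b)"
| "plug (Incl c d) b = Incl (map (\<lambda>t. plug_atm t b) c) (map (\<lambda>t. plug_atm t b) d)"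
| "plug (And \<alpha> \<beta>) b = And (plug \<alpha> b) (plug \<beta> b)"
| "plug (Or \<alpha> \<beta>) b = Or (plug \<alpha> b) (plug \<beta> b)"

text \<open>Side conditions referring to \<open>CPL\<close> occur exactly where a rule introduces material that
  is not already constrained by its premises; lemma \<open>deriv_CPL\<close> shows that they suffice to keep
  derivations within the logic.  In particular, the left-hand sides of all inclusion atoms
  below are sequences of constants.\<close>

inductive deriv :: "'p fm set \<Rightarrow> 'p fm \<Rightarrow> bool"  (infix "\<turnstile>" 50) where
  Assm: "\<Gamma> \<subseteq> CPL \<Longrightarrow> \<phi> \<in> \<Gamma> \<Longrightarrow> \<Gamma> \<turnstile> \<phi>"
| Weaken: "\<Gamma> \<turnstile> \<phi> \<Longrightarrow> \<Gamma>' \<subseteq> CPL \<Longrightarrow> \<Gamma> \<union> \<Gamma>' \<turnstile> \<phi>"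
| TopI: "\<Gamma> \<subseteq> CPL \<Longrightarrow> \<Gamma> \<turnstile> Top"
| NegI: "\<Delta> \<subseteq> Classical \<Longrightarrow> \<alpha> \<in> Classical \<Longrightarrow> insert \<alpha> \<Delta> \<turnstile> Bot \<Longrightarrow> \<Delta> \<turnstile> Neg \<alpha>"
| RAA: "\<Delta> \<subseteq> Classical \<Longrightarrow> \<alpha> \<in> Classical \<Longrightarrow> insert (Neg \<alpha>) \<Delta> \<turnstile> Bot \<Longrightarrow> \<Delta> \<turnstile> \<alpha>"
| NegE: "\<alpha> \<in> Classical \<Longrightarrow> \<phi> \<in> CPL \<Longrightarrow> \<Gamma> \<turnstile> \<alpha> \<Longrightarrow> \<Gamma> \<turnstile> Neg \<alpha> \<Longrightarrow> \<Gamma> \<turnstile> \<phi>"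
| AndI: "\<Gamma> \<turnstile> \<phi> \<Longrightarrow> \<Gamma> \<turnstile> \<psi> \<Longrightarrow> \<Gamma> \<turnstile> And \<phi> \<psi>"
| AndE1: "\<Gamma> \<turnstile> And \<phi> \<psi> \<Longrightarrow> \<Gamma> \<turnstile> \<phi>"
| AndE2: "\<Gamma> \<turnstile> And \<phi> \<psi> \<Longrightarrow> \<Gamma> \<turnstile> \<psi>"
| OrI1: "\<psi> \<in> CPL \<Longrightarrow> \<Gamma> \<turnstile> \<phi> \<Longrightarrow> \<Gamma> \<turnstile> Or \<phi> \<psi>"
| OrI2: "\<psi> \<in> CPL \<Longrightarrow> \<Gamma> \<turnstile> \<phi> \<Longrightarrow> \<Gamma> \<turnstile> Or \<psi> \<phi>"
| OrE: "\<Delta> \<subseteq> Classical \<Longrightarrow> \<Gamma> \<turnstile> Or \<phi> \<psi> \<Longrightarrow> insert \<phi> \<Delta> \<turnstile> \<chi> \<Longrightarrow> insert \<psi> \<Delta> \<turnstile> \<chi> \<Longrightarrow>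
    \<Gamma> \<union> \<Delta> \<turnstile> \<chi>"
| InclExc: "length a = length a' \<Longrightarrow> length b = length b' \<Longrightarrow> length c = length c' \<Longrightarrow>
    \<Gamma> \<turnstile> Incl (a @ b @ c) (a' @ b' @ c') \<Longrightarrow> \<Gamma> \<turnstile> Incl (b @ a @ c) (b' @ a' @ c')"
| InclCtr: "length a = length c \<Longrightarrow> length b = length d \<Longrightarrow>
    \<Gamma> \<turnstile> Incl (a @ b) (c @ d) \<Longrightarrow> \<Gamma> \<turnstile> Incl a c"
| InclWk: "length a = length c \<Longrightarrow> length b = length d \<Longrightarrow>
    \<Gamma> \<turnstile> Incl (a @ b) (c @ d) \<Longrightarrow> \<Gamma> \<turnstile> Incl (a @ a @ b) (c @ c @ d)"
| InclTrs: "\<Gamma> \<turnstile> Incl a b \<Longrightarrow> \<Gamma> \<turnstile> Incl b c \<Longrightarrow> \<Gamma> \<turnstile> Incl a c"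
| InclId: "\<Gamma> \<subseteq> CPL \<Longrightarrow> Incl a a \<in> CPL \<Longrightarrow> \<Gamma> \<turnstile> Incl a a"
| InclCmp: "\<alpha> \<in> Classical \<Longrightarrow> vars \<alpha> \<subseteq> {..<length b} \<Longrightarrow>
    \<Gamma> \<turnstile> Incl a b \<Longrightarrow> \<Gamma> \<turnstile> plug \<alpha> b \<Longrightarrow> \<Gamma> \<turnstile> plug \<alpha> a"
| ExtTop: "\<Gamma> \<turnstile> Incl a b \<Longrightarrow> \<Gamma> \<turnstile> Incl (Con True # a) (Con True # b)"
| ExtBot: "\<Gamma> \<turnstile> Incl a b \<Longrightarrow> \<Gamma> \<turnstile> Incl (Con False # a) (Con False # b)"
| ExtVar: "\<Gamma> \<turnstile> Var p \<Longrightarrow> \<Gamma> \<turnstile> Incl a b \<Longrightarrow> \<Gamma> \<turnstile> Incl (Con True # a) (PVar p # b)"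
| ExtNegVar: "\<Gamma> \<turnstile> Neg (Var p) \<Longrightarrow> \<Gamma> \<turnstile> Incl a b \<Longrightarrow>
    \<Gamma> \<turnstile> Incl (Con False # a) (PVar p # b)"
| OrInclE: "\<Gamma> \<turnstile> Or (And \<phi> (Incl (map Con x) a)) \<psi> \<Longrightarrow>
    insert (Incl (map Con x) a) (insert \<phi> \<Gamma>) \<turnstile> \<chi> \<Longrightarrow>
    insert \<psi> \<Gamma> \<turnstile> \<chi> \<Longrightarrow>
    insert (Incl (map Con x) a) (insert (Or \<phi> \<psi>) \<Gamma>) \<turnstile> \<chi> \<Longrightarrow>
    \<Gamma> \<turnstile> \<chi>"
| InclDst: "\<Gamma> \<turnstile> Or \<phi> \<psi> \<Longrightarrow>
    (\<And>x a. (x, a) \<in> set xas \<Longrightarrow> \<Gamma> \<turnstile> Incl (map Con x) a) \<Longrightarrow>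
    \<Gamma> \<turnstile> Or (foldl And (foldl Or \<phi> (map (\<lambda>(x, a). lits a x) xas))
                    (map (\<lambda>(x, a). Incl (map Con x) a) xas)) \<psi>"

lemma classical_cpl: "classical \<alpha> \<Longrightarrow> cpl \<alpha>"
  by (induction \<alpha>) auto

lemma classical_atm_fm: "classical (atm_fm t)"
  by (cases t) auto

lemma classical_plug: "classical \<alpha> \<Longrightarrow> classical (plug \<alpha> b)"
  by (induction \<alpha>) (auto simp: classical_atm_fm)

lemma classical_lit: "classical (lit a x)"
  by (cases "(a, x)" rule: lit.cases) auto

lemma cpl_foldl_And: "cpl (foldl And \<phi> \<phi>s) \<longleftrightarrow> cpl \<phi> \<and> (\<forall>\<psi>\<in>set \<phi>s. cpl \<psi>)"
  by (induction \<phi>s arbitrary: \<phi>) auto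

lemma cpl_foldl_Or: "cpl (foldl Or \<phi> \<phi>s) \<longleftrightarrow> cpl \<phi> \<and> (\<forall>\<psi>\<in>set \<phi>s. cpl \<psi>)"
  by (induction \<phi>s arbitrary: \<phi>) auto

lemma cpl_conj_list: "cpl (conj_list \<phi>s) \<longleftrightarrow> (\<forall>\<psi>\<in>set \<phi>s. cpl \<psi>)"
  by (cases \<phi>s) (auto simp: cpl_foldl_And)

lemma cpl_lits: "cpl (lits a x)"
  by (auto simp: lits_def cpl_conj_list intro: classical_cpl classical_lit)

lemma deriv_CPL: "\<Gamma> \<turnstile> \<phi> \<Longrightarrow> \<Gamma> \<subseteq> CPL \<and> \<phi> \<in> CPL"
proof (induction rule: deriv.induct)
  case (InclDst \<Gamma> \<phi> \<psi> xas)
  then show ?case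
    by (fastforce simp: CPL_def cpl_foldl_And cpl_foldl_Or cpl_lits)
qed (auto simp: CPL_def Classical_def intro: classical_cpl classical_plug)

end

theory Submission
  imports Defs
begin

text \<open>Soundness is proved by induction on derivations.  Three semantic facts carry it: every
  formula holds in the empty team and is preserved under unions of teams, and classical formulas
  are moreover flat, that is, they hold in a team iff they hold in each of its singletons.
  Flatness reduces the rules for negation and \<open>InclCmp\<close> to ordinary two-valued reasoning at single
  valuations and lets the classical side assumptions \<open>\<Delta>\<close> pass to subteams.  The empty team,
  the only one that satisfies a classical formula together with its negation, accounts for \<open>NegE\<close>;
  as the missing half of a split it also accounts for disjunction introduction.  Union closure makes
  disjunction elimination sound: \<open>\<chi>\<close> holds in both parts of a split team, hence in the whole.

  The rules that are specific to primitive inclusion use that \<open>x \<subseteq> a\<close> with constant \<open>x\<close> says, of a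
  nonempty team, just that some member gives \<open>a\<close> the value \<open>x\<close>.  So the atom is preserved when a
  nonempty team grows, and it can be made true in a disjunct by adding its witnesses to that
  disjunct's part of the team; the witnesses satisfy the literals that describe them.

  The induction cannot be run on \<open>\<Turnstile>\<close> itself: a premise of a rule may contain variables that its
  conclusion lacks, on which a team for the conclusion need not be defined.  But \<open>val\<close> reads an
  undefined variable as false, and with this reading all the arguments above apply to arbitrary
  sets of partial valuations.  The induction therefore ranges over all such sets, whatever the
  domains of their members.\<close>

section \<open>Closure properties of team semantics\<close>

lemma sat_empty: "sat \<phi> {}"
  by (induction \<phi>) auto

lemma sat_OrI: "sat \<phi> Y \<Longrightarrow> sat \<psi> Z \<Longrightarrow> sat (Or \<phi> \<psi>) (Y \<union> Z)"
  by auto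

lemma sat_OrI1: "sat \<phi> X \<Longrightarrow> sat (Or \<phi> \<psi>) X"
  using sat_OrI[of \<phi> X \<psi> "{}"] by (simp only: sat_empty Un_empty_right)

lemma sat_OrI2: "sat \<phi> X \<Longrightarrow> sat (Or \<psi> \<phi>) X"
  using sat_OrI[of \<psi> "{}" \<phi> X] by (simp only: sat_empty Un_empty_left)

lemma sat_Un: "sat \<phi> X \<Longrightarrow> sat \<phi> Y \<Longrightarrow> sat \<phi> (X \<union> Y)"
proof (induction \<phi> arbitrary: X Y)
  case (Or \<phi> \<psi>)
  obtain A B where X: "X = A \<union> B" "sat \<phi> A" "sat \<psi> B" using Or.prems(1) by auto
  obtain C D where Y: "Y = C \<union> D" "sat \<phi> C" "sat \<psi> D" using Or.prems(2) by auto
  have "sat (Or \<phi> \<psi>) ((A \<union> C) \<union> (B \<union> D))"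
    using X Y Or.IH by (intro sat_OrI) auto
  moreover have "(A \<union> C) \<union> (B \<union> D) = X \<union> Y" using X Y by auto
  ultimately show ?case by simp
next
  case (Incl a b)
  then show ?case unfolding sat.simps by (meson UnE UnI1 UnI2)
qed auto

lemma sat_Or_singleton: "sat (Or \<phi> \<psi>) {v} \<longleftrightarrow> sat \<phi> {v} \<or> sat \<psi> {v}"
proof
  assume "sat (Or \<phi> \<psi>) {v}"
  then obtain Y Z where "{v} = Y \<union> Z" "sat \<phi> Y" "sat \<psi> Z" by auto
  moreover from this have "Y = {v} \<or> Z = {v}" by blast
  ultimately show "sat \<phi> {v} \<or> sat \<psi> {v}" by auto
next
  assume "sat \<phi> {v} \<or> sat \<psi> {v}"
  then show "sat (Or \<phi> \<psi>) {v}"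
    by (metis sat_OrI1 sat_OrI2)
qed

text \<open>Only disjunction needs an argument: a team all of whose singletons satisfy \<open>\<alpha> \<or> \<beta>\<close> is split
  into the members that satisfy \<open>\<alpha>\<close> and those that satisfy \<open>\<beta>\<close>.\<close>

lemma classical_flat: "classical \<alpha> \<Longrightarrow> sat \<alpha> X \<longleftrightarrow> (\<forall>v\<in>X. sat \<alpha> {v})"
proof (induction \<alpha> arbitrary: X)
  case (Neg \<alpha>)
  show ?case by simp
next
  case (And \<alpha> \<beta>)
  then show ?case unfolding classical.simps sat.simps by blast
next
  case (Or \<alpha> \<beta>)
  have flat: "sat \<alpha> Y \<longleftrightarrow> (\<forall>v\<in>Y. sat \<alpha> {v})" "sat \<beta> Y \<longleftrightarrow> (\<forall>v\<in>Y. sat \<beta> {v})" for Y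
    using Or.IH(1)[of Y] Or.IH(2)[of Y] Or.prems unfolding classical.simps by blast+
  show ?case
  proof
    assume "sat (Or \<alpha> \<beta>) X"
    then obtain Y Z where "X = Y \<union> Z" "sat \<alpha> Y" "sat \<beta> Z" by auto
    then show "\<forall>v\<in>X. sat (Or \<alpha> \<beta>) {v}"
      unfolding sat_Or_singleton using flat by blast
  next
    assume "\<forall>v\<in>X. sat (Or \<alpha> \<beta>) {v}"
    then have split: "{v\<in>X. sat \<alpha> {v}} \<union> {v\<in>X. sat \<beta> {v}} = X"
      unfolding sat_Or_singleton by blast
    have "sat (Or \<alpha> \<beta>) ({v\<in>X. sat \<alpha> {v}} \<union> {v\<in>X. sat \<beta> {v}})"
      using flat(1)[of "{v\<in>X. sat \<alpha> {v}}"] flat(2)[of "{v\<in>X. sat \<beta> {v}}"]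
      by (intro sat_OrI) blast+
    then show "sat (Or \<alpha> \<beta>) X" unfolding split .
  qed
qed simp_all

lemma classical_downward:
  assumes "\<Delta> \<subseteq> Classical" and "\<forall>\<delta>\<in>\<Delta>. sat \<delta> X" and "Y \<subseteq> X"
  shows "\<forall>\<delta>\<in>\<Delta>. sat \<delta> Y"
proof
  fix \<delta> assume "\<delta> \<in> \<Delta>"
  then have "classical \<delta>" "sat \<delta> X" using assms(1,2) unfolding Classical_def by auto
  then show "sat \<delta> Y"
    using assms(3) classical_flat[of \<delta> X] classical_flat[of \<delta> Y] by blast
qed

section \<open>Substitution, literals and iterated connectives\<close>

lemma sat_atm_fm: "sat (atm_fm t) {v} \<longleftrightarrow> val v t"
  by (cases t) auto

text \<open>The semantic content of \<open>InclCmp\<close>: a classical schema sees of its arguments only their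
  truth values.\<close>

lemma sat_plug_cong:
  assumes "map (val v) a = map (val u) b"
  shows "classical \<alpha> \<Longrightarrow> vars \<alpha> \<subseteq> {..<length b} \<Longrightarrow>
    sat (plug \<alpha> a) {v} \<longleftrightarrow> sat (plug \<alpha> b) {u}"
proof (induction \<alpha>)
  case (Var i)
  have "length a = length b" using assms by (rule map_eq_imp_length_eq)
  then have "val v (a ! i) = val u (b ! i)"
    using Var assms by (metis fm.set(1) insert_subset lessThan_iff nth_map)
  then show ?case by (simp add: sat_atm_fm)
next
  case (Or \<alpha> \<beta>)
  then show ?case unfolding plug.simps sat_Or_singleton by simp
qed auto

lemma sat_lit: "(\<And>v. v \<in> U \<Longrightarrow> val v t = c) \<Longrightarrow> sat (lit t c) U"
  by (cases "(t, c)" rule: lit.cases) auto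

lemma sat_foldl_And: "sat (foldl And \<phi> \<phi>s) X \<longleftrightarrow> sat \<phi> X \<and> (\<forall>\<psi>\<in>set \<phi>s. sat \<psi> X)"
  by (induction \<phi>s arbitrary: \<phi>) auto

lemma sat_conj_list: "sat (conj_list \<phi>s) X \<longleftrightarrow> (\<forall>\<psi>\<in>set \<phi>s. sat \<psi> X)"
  by (cases \<phi>s) (auto simp: sat_foldl_And)

lemma sat_lits: "(\<And>v. v \<in> U \<Longrightarrow> map (val v) a = x) \<Longrightarrow> sat (lits a x) U"
  unfolding lits_def sat_conj_list by (fastforce simp: set_zip intro: sat_lit)

lemma sat_foldl_Or:
  "sat \<phi> Y \<Longrightarrow> (\<And>i. i \<in> set is \<Longrightarrow> sat (f i) (U i)) \<Longrightarrow>
    sat (foldl Or \<phi> (map f is)) (Y \<union> (\<Union>i\<in>set is. U i))"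
proof (induction "is" arbitrary: \<phi> Y)
  case (Cons i "is")
  have "sat (Or \<phi> (f i)) (Y \<union> U i)" using Cons.prems by (intro sat_OrI) auto
  from Cons.IH[OF this] Cons.prems(2) show ?case by (simp add: Un_assoc)
qed simp

section \<open>Primitive inclusion atoms\<close>

lemma sat_Incl_Con:
  "sat (Incl (map Con x) a) X \<longleftrightarrow> X = {} \<or> (\<exists>u\<in>X. map (val u) a = x)"
proof -
  have "map (val v \<circ> Con) x = x" for v :: "'a \<rightharpoonup> bool"
    by (rule map_idI) simp
  then show ?thesis by (auto simp: eq_commute)
qed

text \<open>This is the case distinction behind \<open>OrInclE\<close>.  If the part of the team that satisfies the
  left disjunct is empty, the whole team satisfies \<open>\<psi>\<close>; otherwise that part contains a witness
  of the atom, which serves the whole team as well.\<close>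

lemma sat_Or_Incl_cases:
  assumes "sat (Or (And \<phi> (Incl (map Con x) a)) \<psi>) X"
  shows "sat \<psi> X \<or> sat (Or \<phi> \<psi>) X \<and> sat (Incl (map Con x) a) X"
proof -
  obtain Y Z where X: "X = Y \<union> Z" and Y: "sat \<phi> Y" "sat (Incl (map Con x) a) Y" and Z: "sat \<psi> Z"
    using assms by auto
  show ?thesis
  proof (cases "Y = {}")
    case True
    then show ?thesis using X Z by simp
  next
    case False
    then have "sat (Incl (map Con x) a) X" using X Y(2) unfolding sat_Incl_Con by auto
    moreover have "sat (Or \<phi> \<psi>) X" unfolding X using Y(1) Z by (rule sat_OrI)
    ultimately show ?thesis by simp
  qed
qed

text \<open>If \<open>Y\<close> is the part of the team that satisfies \<open>\<phi>\<close>, it is enlarged by all the members of the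
  team that witness one of the atoms.  The new members are absorbed by the added disjuncts, and
  the part of \<open>\<psi>\<close> stays as it is, since the parts of a split may overlap.\<close>

lemma sat_Incl_distribute:
  assumes or: "sat (Or \<phi> \<psi>) X"
    and incl: "\<And>x a. (x, a) \<in> set xas \<Longrightarrow> sat (Incl (map Con x) a) X"
  shows "sat (Or (foldl And (foldl Or \<phi> (map (\<lambda>(x, a). lits a x) xas))
                    (map (\<lambda>(x, a). Incl (map Con x) a) xas)) \<psi>) X"
proof (cases "X = {}")
  case True
  then show ?thesis using sat_empty by blast
next
  case False
  obtain Y Z where X: "X = Y \<union> Z" and Y: "sat \<phi> Y" and Z: "sat \<psi> Z" using or by auto
  define U where "U = (\<lambda>(x, a). {u\<in>X. map (val u) a = x})"
  define Y' where "Y' = Y \<union> (\<Union>xa\<in>set xas. U xa)"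
  have lits: "sat (foldl Or \<phi> (map (\<lambda>(x, a). lits a x) xas)) Y'"
    unfolding Y'_def using Y by (rule sat_foldl_Or) (auto simp: U_def intro: sat_lits)
  have atoms: "sat (Incl (map Con x) a) Y'" if xa: "(x, a) \<in> set xas" for x a
  proof -
    have "sat (Incl (map Con x) a) X" using incl xa .
    then obtain u where "u \<in> X" "map (val u) a = x"
      using False unfolding sat_Incl_Con by auto
    then have "u \<in> Y'" using xa unfolding Y'_def U_def by auto
    then show ?thesis using \<open>map (val u) a = x\<close> unfolding sat_Incl_Con by auto
  qed
  have "sat (foldl And (foldl Or \<phi> (map (\<lambda>(x, a). lits a x) xas))
      (map (\<lambda>(x, a). Incl (map Con x) a) xas)) Y'"
    unfolding sat_foldl_And using lits atoms by (auto simp del: sat.simps)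
  from sat_OrI[OF this Z] have "sat (Or (foldl And (foldl Or \<phi> (map (\<lambda>(x, a). lits a x) xas))
      (map (\<lambda>(x, a). Incl (map Con x) a) xas)) \<psi>) (Y' \<union> Z)" .
  moreover have "Y' \<union> Z = X" unfolding Y'_def U_def X by auto
  ultimately show ?thesis by simp
qed

section \<open>Soundness\<close>

text \<open>Here \<open>X\<close> is any set of partial valuations: unlike in \<open>\<Turnstile>\<close>, nothing is asked of their domains,
  so that the induction hypotheses apply to premises with additional variables.\<close>

lemma deriv_sound: "\<Gamma> \<turnstile> \<phi> \<Longrightarrow> \<forall>\<gamma>\<in>\<Gamma>. sat \<gamma> X \<Longrightarrow> sat \<phi> X"
proof (induction arbitrary: X rule: deriv.induct)
  case (NegI \<Delta> \<alpha>)
  have "\<not> sat \<alpha> {v}" if "v \<in> X" for v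
    using classical_downward[OF NegI.hyps(1) NegI.prems, of "{v}"] NegI.IH[of "{v}"] that by auto
  then show ?case by simp
next
  case (RAA \<Delta> \<alpha>)
  have "sat \<alpha> {v}" if "v \<in> X" for v
    using classical_downward[OF RAA.hyps(1) RAA.prems, of "{v}"] RAA.IH[of "{v}"] that by auto
  then show ?case using classical_flat[of \<alpha> X] RAA.hyps(2) unfolding Classical_def by blast
next
  case (NegE \<alpha> \<phi> \<Gamma>)
  have "sat \<alpha> {v}" if "v \<in> X" for v
    using NegE.IH(1)[OF NegE.prems] NegE.hyps(1) that classical_flat[of \<alpha> X]
    unfolding Classical_def by blast
  then have "X = {}" using NegE.IH(2)[OF NegE.prems] by auto
  then show ?case using sat_empty by blast
next
  case (OrI1 \<psi> \<Gamma> \<phi>)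
  then show ?case by (simp only: sat_OrI1)
next
  case (OrI2 \<psi> \<Gamma> \<phi>)
  then show ?case by (simp only: sat_OrI2)
next
  case (OrE \<Delta> \<Gamma> \<phi> \<psi> \<chi>)
  have "sat (Or \<phi> \<psi>) X" using OrE.IH(1) OrE.prems by blast
  then obtain Y Z where X: "X = Y \<union> Z" "sat \<phi> Y" "sat \<psi> Z" by auto
  have "\<forall>\<delta>\<in>\<Delta>. sat \<delta> W" if "W \<subseteq> X" for W
    using classical_downward[OF OrE.hyps(1) _ that] OrE.prems by blast
  then have "sat \<chi> Y" "sat \<chi> Z" using OrE.IH(2,3) X by auto
  then show ?case unfolding X(1) by (rule sat_Un)
next
  case (InclExc a a' b b' c c' \<Gamma>)
  show ?case using InclExc.IH[OF InclExc.prems] InclExc.hyps by (simp, meson)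
next
  case (InclCtr a c b d \<Gamma>)
  show ?case using InclCtr.IH[OF InclCtr.prems] InclCtr.hyps by (simp, meson)
next
  case (InclWk a c b d \<Gamma>)
  show ?case using InclWk.IH[OF InclWk.prems] InclWk.hyps by simp
next
  case (InclTrs \<Gamma> a b c)
  show ?case using InclTrs.IH[OF InclTrs.prems] by (simp, metis)
next
  case (InclCmp \<alpha> b \<Gamma> a)
  have \<alpha>: "classical \<alpha>" using InclCmp.hyps unfolding Classical_def by simp
  have "sat (plug \<alpha> a) {v}" if v: "v \<in> X" for v
  proof -
    obtain u where u: "u \<in> X" "map (val v) a = map (val u) b"
      using InclCmp.IH(1)[OF InclCmp.prems] v by auto
    have "sat (plug \<alpha> b) {u}"
      using InclCmp.IH(2)[OF InclCmp.prems] u(1) classical_flat[OF classical_plug[OF \<alpha>], of _ X] by blast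
    then show ?thesis using sat_plug_cong[OF u(2) \<alpha> InclCmp.hyps(2)] by simp
  qed
  then show ?case using classical_flat[OF classical_plug[OF \<alpha>], of _ X] by blast
next
  case (ExtVar \<Gamma> p a b)
  show ?case using ExtVar.IH[OF ExtVar.prems] by simp
next
  case (ExtNegVar \<Gamma> p a b)
  show ?case using ExtNegVar.IH[OF ExtNegVar.prems] by simp
next
  case (OrInclE \<Gamma> \<phi> x a \<psi> \<chi>)
  show ?case
    using sat_Or_Incl_cases[OF OrInclE.IH(1)[OF OrInclE.prems]] OrInclE.IH(3,4) OrInclE.prems
    by (auto simp del: sat.simps)
next
  case (InclDst \<Gamma> \<phi> \<psi> xas)
  show ?case using InclDst.IH InclDst.prems by (intro sat_Incl_distribute) auto
qed auto

theorem theorem4p12: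
  fixes \<Gamma> :: "'p fm set" and \<phi> :: "'p fm"
  assumes "\<Gamma> \<union> {\<phi>} \<subseteq> CPL"
    and "\<Gamma> \<turnstile> \<phi>"
  shows "\<Gamma> \<Turnstile> \<phi>"
  using deriv_sound[OF assms(2)] unfolding entails_def by blast

end
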